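(* Let $P_{ij}$ ($i\in\{1,\dots,n_c\}$, $j\in\{1,\dots,n_v\}$) be $N\times N$ permutation matrices, and let $H=(P_{ij})$ be the resulting $n_cN\times n_vN$ matrix. For $i,j\in\{1,\dots,n_c\}$ put $C_{ij}=C_{ji}^{\mathsf T}=\sum_{k=1}^{n_v}P_{ik}P_{jk}^{\mathsf T}$ (over $\mathbb Z$), and let $C_H$ be the $n_c\times n_c$ block matrix with zero diagonal blocks and $(i,j)$ block $C_{ij}$ for $i\ne j$. Then $\mathrm{girth}(H)>8$ if and only if $$C_H\triangle 0=0\quad\text{and}\quad C_H^2\triangle (I+C_H)=0 .$$ Equivalently, $\mathrm{girth}(H)>8$ if and only if $$C_{ij}\triangle 0=0\quad\text{and}\quad \Big(\sum_{\substack{l=1\\ l\ne j}}^{n_c} C_{il}C_{lj}\Big)\triangle C_{ij}=0\quad\text{for all } i,j\in\{1,\dots,n_c\},\ i\ne j.$$ Moreover, if $n_c=3$, then $\mathrm{girth}(H)>8$ if and only if $\mathrm{girth}(C_H)>4$.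
   Context: The Tanner graph of a matrix with non-negative integer entries is the bipartite (multi)graph with one check node per row, one variable node per column, and as many edges between check node $a$ and variable node $b$ as the $(a,b)$ entry. $\mathrm{girth}(M)$ is the length of a shortest cycle in the Tanner graph of $M$; a graph with multiple edges is said to have girth $2$. For non-negative integers $e,f$, $e\triangle f:=1$ if $e\ge 2$ and $f=0$, and $e\triangle f:=0$ otherwise; for matrices of equal size, $\triangle$ is applied entrywise. All matrix operations are over $\mathbb Z$.
   Formalization: In the "Equivalently" part, the condition on the sum over l ≠ j is required for all i, j including i = j (only C_ij △ 0 = 0 is restricted to i ≠ j); as printed, the "if" direction fails, e.g. n_c = n_v = N = 2 with P_11 = P_12 = P_21 = I and P_22 the swap. *)

theory Defs
  imports "HOL-Analysis.Analysis" "HOL-Library.Extended_Nat"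
begin

text \<open>
  An element of type \<^typ>\<open>int ^ 'v ^ 'c\<close> is an integer matrix with rows indexed by \<open>'c\<close> and
  columns indexed by \<open>'v\<close>. A block matrix is indexed by pairs: first the index of the block,
  then the position inside the block.
\<close>

definition permutation_matrix :: "int ^ 'n ^ 'n \<Rightarrow> bool" where
  "permutation_matrix A \<longleftrightarrow>
     (\<exists>\<pi>. bij \<pi> \<and> A = (\<chi> r c. if c = \<pi> r then 1 else 0))"


text \<open>
  The Tanner graph: \<open>Inl a\<close> is the check node of row \<open>a\<close>, \<open>Inr b\<close> the variable node of column
  \<open>b\<close>, and \<open>(a, b, 0), \<dots>, (a, b, m - 1)\<close> are the \<open>m\<close> parallel edges between them, where \<open>m\<close> is
  the \<open>(a, b)\<close> entry. It is only meant for matrices with non-negative entries.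
\<close>

definition tanner_edges :: "int ^ 'v ^ 'c \<Rightarrow> ('c \<times> 'v \<times> nat) set" where
  "tanner_edges M = {(a, b, k). k < nat (M $ a $ b)}"

fun edge_ends :: "'c \<times> 'v \<times> nat \<Rightarrow> ('c + 'v) set" where
  "edge_ends (a, b, k) = {Inl a, Inr b}"

text \<open>
  A cycle of length \<open>L \<ge> 2\<close> has \<open>L\<close> distinct nodes and \<open>L\<close> distinct edges, the \<open>i\<close>-th edge joining
  the \<open>i\<close>-th node to its cyclic successor. Two parallel edges form a cycle of length 2, so a
  graph with multiple edges automatically has girth 2; a graph without cycles has girth \<open>\<infinity>\<close>.
\<close>

definition tanner_cycle ::
    "int ^ 'v ^ 'c \<Rightarrow> ('c + 'v) list \<Rightarrow> ('c \<times> 'v \<times> nat) list \<Rightarrow> bool" where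
  "tanner_cycle M vs es \<longleftrightarrow>
     2 \<le> length es \<and> length vs = length es \<and>
     distinct vs \<and> distinct es \<and> set es \<subseteq> tanner_edges M \<and>
     (\<forall>i < length es. edge_ends (es ! i) = {vs ! i, vs ! (Suc i mod length es)})"

definition girth :: "int ^ 'v ^ 'c \<Rightarrow> enat" where
  "girth M = Inf {enat (length es) | vs es. tanner_cycle M vs es}"


definition tri :: "int \<Rightarrow> int \<Rightarrow> int" where
  "tri e f = (if e \<ge> 2 \<and> f = 0 then 1 else 0)"

definition tri_mat :: "int ^ 'v ^ 'c \<Rightarrow> int ^ 'v ^ 'c \<Rightarrow> int ^ 'v ^ 'c"
    (infix "\<triangle>" 55) where
  "E \<triangle> F = (\<chi> a b. tri (E $ a $ b) (F $ a $ b))"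


definition block_matrix :: "('c::finite \<Rightarrow> 'v::finite \<Rightarrow> int ^ 'n ^ 'n) \<Rightarrow> int ^ ('v \<times> 'n) ^ ('c \<times> 'n)" where
  "block_matrix B = (\<chi> x y. B (fst x) (fst y) $ snd x $ snd y)"

text \<open>
  The diagonal block \<open>C_block P i i\<close> is \<open>CARD('v)\<close> times the identity for permutation matrices
  \<open>P\<close>, whereas \<open>C_mat P\<close> has zero diagonal blocks.
\<close>

definition C_block :: "('c \<Rightarrow> 'v::finite \<Rightarrow> int ^ 'n ^ 'n) \<Rightarrow> 'c \<Rightarrow> 'c \<Rightarrow> int ^ 'n ^ 'n" where
  "C_block P i j = (\<Sum>k\<in>UNIV. P i k ** transpose (P j k))"

lemma C_block_transpose: "C_block P i j = transpose (C_block P j i)"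
  by (simp add: C_block_def vec_eq_iff transpose_def matrix_matrix_mult_def mult.commute)

definition C_mat ::
    "('c::finite \<Rightarrow> 'v::finite \<Rightarrow> int ^ 'n ^ 'n) \<Rightarrow> int ^ ('c \<times> 'n) ^ ('c \<times> 'n)" where
  "C_mat P = block_matrix (\<lambda>i j. if i = j then 0 else C_block P i j)"

end

theory Submission
  imports Defs
begin

text \<open>
  The matrix \<open>C_mat P\<close> counts the common neighbours of two distinct check nodes: check nodes of the same
  block have none, since the blocks are permutation matrices. Its entries are at most 1 iff there
  are no 4-cycles, and then a violation of the second condition is a pair of check nodes without
  common neighbour that are joined by two different paths of length 4. Two such paths form an
  8-cycle, or contain a shorter cycle. Conversely, an 8-cycle either gives a violation or has a
  chord path that cuts off a 6-cycle, and a 6-cycle always gives a violation, because every variable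
  node has a neighbour in every block row. For three block rows, a 4-cycle in the graph of \<open>C_mat P\<close>
  consists of two pairs of nodes; if the condition holds, all four nodes lie in different blocks.
\<close>

section \<open>Tanner cycles as alternating lists of rows and columns\<close>

text \<open>A cycle of length twice \<open>length us\<close>, starting at a check node: column
  \<open>us ! i\<close> lies between row \<open>as ! i\<close> and its cyclic successor. Edges need
  no names here, because from length 4 on the nodes determine the pairs of rows and columns to be
  joined.\<close>

definition alternating_cycle :: "int ^ 'v ^ 'c \<Rightarrow> 'c list \<Rightarrow> 'v list \<Rightarrow> bool" where
  "alternating_cycle M as us \<longleftrightarrow>
     2 \<le> length us \<and> length as = length us \<and> distinct as \<and> distinct us \<and>
     (\<forall>i < length us. 0 < M $ (as ! i) $ (us ! i) \<and> 0 < M $ (as ! (Suc i mod length us)) $ (us ! i))"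

lemma tanner_cycle_rotate1:
  assumes "tanner_cycle M vs es"
  shows "tanner_cycle M (rotate1 vs) (rotate1 es)"
proof -
  let ?n = "length es"
  have c: "2 \<le> ?n" "length vs = ?n" "distinct vs" "distinct es" "set es \<subseteq> tanner_edges M"
    and e: "\<And>i. i < ?n \<Longrightarrow> edge_ends (es ! i) = {vs ! i, vs ! (Suc i mod ?n)}"
    using assms by (auto simp: tanner_cycle_def)
  have lt: "Suc i mod ?n < ?n" for i using c(1) by (intro mod_less_divisor) linarith
  have "edge_ends (rotate1 es ! i) = {rotate1 vs ! i, rotate1 vs ! (Suc i mod ?n)}" if "i < ?n" for i
    using e[OF lt] lt c that by (simp add: nth_rotate1)
  then show ?thesis using c by (simp add: tanner_cycle_def)
qed

lemma tanner_cycle_edge: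
  assumes "tanner_cycle M vs es" "i < length es"
  obtains a b where
    "{vs ! i, vs ! (Suc i mod length es)} = {Inl a, Inr b}" "0 < M $ a $ b"
proof -
  obtain a b k where e: "es ! i = (a, b, k)" by (metis prod_cases3)
  have "es ! i \<in> tanner_edges M"
    using assms nth_mem unfolding tanner_cycle_def by blast
  then have "0 < M $ a $ b" by (auto simp: e tanner_edges_def)
  moreover have "{vs ! i, vs ! (Suc i mod length es)} = {Inl a, Inr b}"
    using assms e unfolding tanner_cycle_def by (metis edge_ends.simps)
  ultimately show thesis using that by blast
qed

lemma tanner_cycle_isl_Suc:
  assumes "tanner_cycle M vs es" "i < length es"
  shows "isl (vs ! (Suc i mod length es)) \<longleftrightarrow> \<not> isl (vs ! i)"
  using tanner_cycle_edge[OF assms] by (metis doubleton_eq_iff isl_def sum.disc(2))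

text \<open>Each edge changes sides, so the parity of the position decides the side. Closing up the
  cycle then forces an even length.\<close>

lemma tanner_cycle_isl_nth:
  assumes "tanner_cycle M vs es" "i < length es"
  shows "isl (vs ! i) \<longleftrightarrow> (isl (vs ! 0) \<longleftrightarrow> even i)"
  using assms(2)
proof (induction i)
  case (Suc i)
  then show ?case using tanner_cycle_isl_Suc[OF assms(1), of i] by auto
qed simp

lemma tanner_cycle_even_length:
  assumes "tanner_cycle M vs es"
  shows "even (length es)"
proof -
  obtain n where n: "length es = Suc n"
    using assms by (cases "length es") (auto simp: tanner_cycle_def)
  show ?thesis
    using tanner_cycle_isl_Suc[OF assms, of n] tanner_cycle_isl_nth[OF assms, of n] n by auto
qed

text \<open>After at most one rotation the cycle starts at a check node; then the even positions are
  the rows and the odd positions the columns.\<close>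

lemma tanner_cycle_imp_alternating_cycle:
  assumes c: "tanner_cycle M vs es" and len: "length es = 2 * k" "2 \<le> k"
  shows "\<exists>as us. alternating_cycle M as us \<and> length us = k"
proof -
  obtain vs es where c: "tanner_cycle M vs es" and len': "length es = 2 * k" and l0: "isl (vs ! 0)"
  proof (cases "isl (vs ! 0)")
    case False
    have "isl (rotate1 vs ! 0)"
      using False tanner_cycle_isl_Suc[OF c, of 0] c len
      by (simp add: nth_rotate1 tanner_cycle_def)
    then show thesis using that[OF tanner_cycle_rotate1[OF c]] len by simp
  qed (use that c len in blast)
  have dv: "distinct vs" and lv: "length vs = 2 * k" using c len' by (auto simp: tanner_cycle_def)
  define as where "as = map (\<lambda>i. projl (vs ! (2 * i))) [0..<k]"
  define us where "us = map (\<lambda>i. projr (vs ! (2 * i + 1))) [0..<k]"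
  have ev: "vs ! (2 * i) = Inl (as ! i)" if "i < k" for i
    using tanner_cycle_isl_nth[OF c, of "2 * i"] that len' l0 by (auto simp: as_def)
  have od: "vs ! (Suc (2 * i)) = Inr (us ! i)" if "i < k" for i
    using tanner_cycle_isl_nth[OF c, of "2 * i + 1"] that len' l0
    by (cases "vs ! (Suc (2 * i))") (auto simp: us_def)
  have lens: "length as = k" "length us = k" by (auto simp: as_def us_def)
  have "distinct as" unfolding distinct_conv_nth
  proof (intro allI impI)
    fix i j assume "i < length as" "j < length as" "i \<noteq> j"
    then show "as ! i \<noteq> as ! j"
      using dv ev[of i] ev[of j] lens lv nth_eq_iff_index_eq[of vs "2 * i" "2 * j"] by auto
  qed
  moreover have "distinct us" unfolding distinct_conv_nth
  proof (intro allI impI)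
    fix i j assume "i < length us" "j < length us" "i \<noteq> j"
    then show "us ! i \<noteq> us ! j"
      using dv od[of i] od[of j] lens lv nth_eq_iff_index_eq[of vs "Suc (2 * i)" "Suc (2 * j)"] by auto
  qed
  moreover have "0 < M $ (as ! i) $ (us ! i) \<and> 0 < M $ (as ! (Suc i mod k)) $ (us ! i)" if i: "i < k" for i
  proof
    show "0 < M $ (as ! i) $ (us ! i)"
      using tanner_cycle_edge[OF c, of "2 * i"] i len' ev[OF i] od[OF i]
      by (auto simp: doubleton_eq_iff)
    \<comment> \<open>The edge leaving a column at an odd position may wrap around; wrapping modulo
      \<open>2 * k\<close> in the node list is wrapping modulo \<open>k\<close> in the row
      list.\<close>
    have *: "Suc (Suc (2 * i)) mod (2 * k) = 2 * (Suc i mod k)"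
      by (metis mult_Suc_right add_2_eq_Suc mult_mod_right)
    have "Suc i mod k < k" using i by simp
    then show "0 < M $ (as ! (Suc i mod k)) $ (us ! i)"
      using tanner_cycle_edge[OF c, of "Suc (2 * i)"] i len' ev[of "Suc i mod k"] od[OF i] *
      by (auto simp: doubleton_eq_iff)
  qed
  ultimately have "alternating_cycle M as us"
    using lens len by (simp add: alternating_cycle_def)
  then show ?thesis using lens by blast
qed

lemma alternating_cycle_imp_tanner_cycle:
  assumes "alternating_cycle M as us"
  shows "\<exists>vs es. tanner_cycle M vs es \<and> length es = 2 * length us"
proof -
  define k where "k = length us"
  have k: "2 \<le> k" "length as = k" "length us = k" and d: "distinct as" "distinct us"
    and M: "\<And>i. i < k \<Longrightarrow> 0 < M $ (as ! i) $ (us ! i)"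
      "\<And>i. i < k \<Longrightarrow> 0 < M $ (as ! (Suc i mod k)) $ (us ! i)"
    using assms by (auto simp: alternating_cycle_def k_def)
  define f where "f i = (if even i then Inl (as ! (i div 2)) else Inr (us ! (i div 2)))" for i
  \<comment> \<open>Edge \<open>i\<close> joins \<open>f i\<close> to its successor. Its row is the
    current one for even \<open>i\<close> and the next one for odd \<open>i\<close>, hence
    \<open>Suc i div 2\<close>; the index 0 picks the first of the parallel edges.\<close>
  define g where "g i = (as ! ((Suc i div 2) mod k), us ! (i div 2), 0 :: nat)" for i
  have ne: "as ! i \<noteq> as ! (Suc i mod k)" if "i < k" for i
    using that k d nth_eq_iff_index_eq[of as i "Suc i mod k"] by (simp add: mod_Suc)
  have f: "inj_on f {0..<2 * k}"
  proof (rule inj_onI)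
    fix i j assume ij: "i \<in> {0..<2 * k}" "j \<in> {0..<2 * k}" and eq: "f i = f j"
    then have "even i = even j" "i div 2 = j div 2"
      using d k by (auto simp: f_def nth_eq_iff_index_eq split: if_splits)
    then show "i = j" by (metis div_mult_mod_eq mod2_eq_if)
  qed
  have g: "inj_on g {0..<2 * k}"
  proof (rule inj_onI)
    fix i j assume ij: "i \<in> {0..<2 * k}" "j \<in> {0..<2 * k}" and eq: "g i = g j"
    then have div: "i div 2 = j div 2" and
      as: "as ! ((Suc i div 2) mod k) = as ! ((Suc j div 2) mod k)"
      using d k by (auto simp: g_def nth_eq_iff_index_eq)
    have lt: "i div 2 < k" using ij by auto
    have ev: "Suc i div 2 mod k = i div 2" if "even i" "i div 2 < k" for i using that by simp
    have od: "Suc i div 2 mod k = Suc (i div 2) mod k" if "odd i" for i using that by simp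
    show "i = j"
    proof (cases "even i = even j")
      \<comment> \<open>Two edges at the same column in positions of different parity lead to
        cyclically consecutive rows, which differ because \<open>k\<close> is at least 2.\<close>
      case False
      then have "as ! (i div 2) = as ! (Suc (i div 2) mod k)"
        using as div lt ev[of i] ev[of j] od[of i] od[of j] by (cases "even i") simp_all
      then show ?thesis using ne[OF lt] by simp
    next
      case True
      then show ?thesis using div by (metis div_mult_mod_eq mod2_eq_if)
    qed
  qed
  have "tanner_cycle M (map f [0..<2 * k]) (map g [0..<2 * k])"
    unfolding tanner_cycle_def
  proof (intro conjI)
    show "set (map g [0..<2 * k]) \<subseteq> tanner_edges M"
    proof -
      have "0 < M $ (as ! ((Suc i div 2) mod k)) $ (us ! (i div 2))" if "i < 2 * k" for i
        using M[of "i div 2"] that by (cases "even i") auto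
      then show ?thesis by (auto simp: g_def tanner_edges_def)
    qed
    show "\<forall>i<length (map g [0..<2 * k]). edge_ends (map g [0..<2 * k] ! i) =
        {map f [0..<2 * k] ! i,
         map f [0..<2 * k] ! (Suc i mod length (map g [0..<2 * k]))}"
    proof (intro allI impI)
      fix i assume "i < length (map g [0..<2 * k])"
      then have i: "i < 2 * k" by simp
      have "edge_ends (g i) = {f i, f (Suc i mod (2 * k))}"
      proof (cases "even i")
        case True
        then obtain m where m: "i = 2 * m" by blast
        then have "Suc i mod (2 * k) = Suc i" using i by simp
        then show ?thesis using m i by (simp add: f_def g_def)
      next
        case False
        then obtain m where m: "i = Suc (2 * m)" by (metis oddE Suc_eq_plus1)
        have "Suc i mod (2 * k) = 2 * (Suc m mod k)"
          unfolding m by (metis mult_Suc_right add_2_eq_Suc mult_mod_right)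
        then show ?thesis using m by (auto simp: f_def g_def)
      qed
      then show "edge_ends (map g [0..<2 * k] ! i) =
        {map f [0..<2 * k] ! i,
         map f [0..<2 * k] ! (Suc i mod length (map g [0..<2 * k]))}"
        using i by simp
    qed
  qed (use k f g in \<open>simp_all add: distinct_map\<close>)
  moreover have "length (map g [0..<2 * k]) = 2 * length us" using k by simp
  ultimately show ?thesis by blast
qed

text \<open>Two distinct edges with the same ends differ only in their index, so at least two
  indices lie below the entry.\<close>

lemma tanner_cycle_length_2_iff:
  "(\<exists>vs es. tanner_cycle M vs es \<and> length es = 2) \<longleftrightarrow> (\<exists>a b. 2 \<le> M $ a $ b)"
proof
  assume "\<exists>vs es. tanner_cycle M vs es \<and> length es = 2"
  then obtain vs es where c: "tanner_cycle M vs es" and len: "length es = 2" by blast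
  obtain e e' where es: "es = [e, e']" using len by (auto simp: length_Suc_conv numeral_2_eq_2)
  obtain x y where vs: "vs = [x, y]"
    using len c by (auto simp: tanner_cycle_def length_Suc_conv numeral_2_eq_2)
  have E: "edge_ends e = {x, y}" "edge_ends e' = {x, y}" "e \<noteq> e'" "e \<in> tanner_edges M" "e' \<in> tanner_edges M"
    using c unfolding tanner_cycle_def es vs by (auto simp: All_less_Suc insert_commute)
  obtain a b k a' b' k' where e: "e = (a, b, k)" "e' = (a', b', k')" by (metis prod_cases3)
  have "edge_ends e = edge_ends e'" using E(1,2) by simp
  then have ab: "a = a'" "b = b'" by (auto simp: e doubleton_eq_iff)
  then have "k \<noteq> k'" "k < nat (M $ a $ b)" "k' < nat (M $ a $ b)"
    using E e by (auto simp: tanner_edges_def)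
  then have "2 \<le> M $ a $ b" by linarith
  then show "\<exists>a b. 2 \<le> M $ a $ b" by blast
next
  assume "\<exists>a b. 2 \<le> M $ a $ b"
  then obtain a b where "2 \<le> M $ a $ b" by blast
  then have "tanner_cycle M [Inl a, Inr b] [(a, b, 0), (a, b, 1)]"
    by (auto simp: tanner_cycle_def tanner_edges_def All_less_Suc numeral_2_eq_2)
  then show "\<exists>vs es. tanner_cycle M vs es \<and> length es = 2"
    by (metis length_Cons list.size(3) numeral_2_eq_2)
qed

section \<open>Girth bounds as absence of short cycles\<close>

lemma girth_gt_iff_no_short_cycle:
  "girth M > enat n \<longleftrightarrow> (\<forall>vs es. tanner_cycle M vs es \<longrightarrow> n < length es)"
proof
  assume "girth M > enat n"
  then show "\<forall>vs es. tanner_cycle M vs es \<longrightarrow> n < length es"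
    unfolding girth_def by (metis (mono_tags, lifting) Inf_lower enat_ord_simps(2) mem_Collect_eq order_less_le_trans)
next
  assume *: "\<forall>vs es. tanner_cycle M vs es \<longrightarrow> n < length es"
  have "enat (Suc n) \<le> girth M" unfolding girth_def
    by (rule Inf_greatest) (use * in \<open>auto simp: Suc_le_eq\<close>)
  then show "girth M > enat n"
    by (metis enat_ord_simps(2) lessI order_less_le_trans)
qed

text \<open>Every cycle has even length \<open>2 * k\<close>: for \<open>k = 1\<close> it is a
  multiple edge, for larger \<open>k\<close> an alternating cycle. The bound on \<open>n\<close>
  makes length 2 one of the forbidden lengths.\<close>

lemma girth_gt_iff:
  assumes "1 \<le> n"
  shows "girth M > enat (2 * n) \<longleftrightarrow>
    (\<forall>a b. M $ a $ b \<le> 1) \<and> (\<forall>as us. alternating_cycle M as us \<longrightarrow> n < length us)"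
proof
  assume "girth M > enat (2 * n)"
  then have *: "\<And>vs es. tanner_cycle M vs es \<Longrightarrow> 2 * n < length es"
    by (simp add: girth_gt_iff_no_short_cycle)
  have "M $ a $ b \<le> 1" for a b
  proof -
    have "\<not> 2 \<le> M $ a $ b"
      using * assms tanner_cycle_length_2_iff[of M] by fastforce
    then show ?thesis by linarith
  qed
  moreover have "\<forall>as us. alternating_cycle M as us \<longrightarrow> n < length us"
    using * alternating_cycle_imp_tanner_cycle by fastforce
  ultimately show "(\<forall>a b. M $ a $ b \<le> 1) \<and> (\<forall>as us. alternating_cycle M as us \<longrightarrow> n < length us)"
    by blast
next
  assume *: "(\<forall>a b. M $ a $ b \<le> 1) \<and> (\<forall>as us. alternating_cycle M as us \<longrightarrow> n < length us)"
  have "2 * n < length es" if c: "tanner_cycle M vs es" for vs es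
  proof -
    obtain k where k: "length es = 2 * k" using tanner_cycle_even_length[OF c] by blast
    have "k \<noteq> 0" using c k by (auto simp: tanner_cycle_def)
    moreover have "\<not> 2 \<le> M $ a $ b" for a b
      using spec[OF spec[OF conjunct1[OF *], of a], of b] by linarith
    then have "k \<noteq> 1"
      using tanner_cycle_length_2_iff[of M] c k by fastforce
    ultimately have "2 \<le> k" by simp
    then show ?thesis using tanner_cycle_imp_alternating_cycle[OF c k] * k by auto
  qed
  then show "girth M > enat (2 * n)" by (simp add: girth_gt_iff_no_short_cycle)
qed

lemma alternating_cycle_2_iff:
  "alternating_cycle M [a, b] [u, v] \<longleftrightarrow> a \<noteq> b \<and> u \<noteq> v \<and>
     0 < M $ a $ u \<and> 0 < M $ b $ u \<and> 0 < M $ b $ v \<and> 0 < M $ a $ v"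
  by (auto simp: alternating_cycle_def All_less_Suc numeral_2_eq_2)

lemma alternating_cycle_3_iff:
  "alternating_cycle M [a, b, c] [u, v, w] \<longleftrightarrow> distinct [a, b, c] \<and> distinct [u, v, w] \<and>
     0 < M $ a $ u \<and> 0 < M $ b $ u \<and> 0 < M $ b $ v \<and> 0 < M $ c $ v \<and> 0 < M $ c $ w \<and> 0 < M $ a $ w"
  by (auto simp: alternating_cycle_def All_less_Suc numeral_2_eq_2)

lemma alternating_cycle_4_iff:
  "alternating_cycle M [a, b, c, d] [u, v, w, x] \<longleftrightarrow> distinct [a, b, c, d] \<and> distinct [u, v, w, x] \<and>
     0 < M $ a $ u \<and> 0 < M $ b $ u \<and> 0 < M $ b $ v \<and> 0 < M $ c $ v \<and>
     0 < M $ c $ w \<and> 0 < M $ d $ w \<and> 0 < M $ d $ x \<and> 0 < M $ a $ x"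
  by (auto simp: alternating_cycle_def All_less_Suc numeral_2_eq_2)

lemma girth_gt_4_iff:
  "girth M > 4 \<longleftrightarrow> (\<forall>a b. M $ a $ b \<le> 1) \<and>
     (\<forall>a b u v. \<not> alternating_cycle M [a, b] [u, v])"
proof -
  have "(\<forall>as us. alternating_cycle M as us \<longrightarrow> 2 < length us) \<longleftrightarrow>
     (\<forall>a b u v. \<not> alternating_cycle M [a, b] [u, v])" (is "?l \<longleftrightarrow> ?r")
  proof
    assume ?l then show ?r by fastforce
  next
    assume r: ?r
    show ?l
    proof (intro allI impI)
      fix as us assume c: "alternating_cycle M as us"
      show "2 < length us"
      proof (rule ccontr)
        assume "\<not> 2 < length us"
        then have l: "length us = Suc (Suc 0)" "length as = Suc (Suc 0)" using c by (auto simp: alternating_cycle_def)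
        then show False using r c by (auto simp: length_Suc_conv)
      qed
    qed
  qed
  then show ?thesis using girth_gt_iff[of 2 M] by (simp add: numeral_eq_enat)
qed

lemma girth_gt_8_iff:
  "girth M > 8 \<longleftrightarrow> (\<forall>a b. M $ a $ b \<le> 1) \<and>
     (\<forall>a b u v. \<not> alternating_cycle M [a, b] [u, v]) \<and>
     (\<forall>a b c u v w. \<not> alternating_cycle M [a, b, c] [u, v, w]) \<and>
     (\<forall>a b c d u v w x. \<not> alternating_cycle M [a, b, c, d] [u, v, w, x])"
proof -
  have "(\<forall>as us. alternating_cycle M as us \<longrightarrow> 4 < length us) \<longleftrightarrow>
     (\<forall>a b u v. \<not> alternating_cycle M [a, b] [u, v]) \<and>
     (\<forall>a b c u v w. \<not> alternating_cycle M [a, b, c] [u, v, w]) \<and>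
     (\<forall>a b c d u v w x. \<not> alternating_cycle M [a, b, c, d] [u, v, w, x])" (is "?l \<longleftrightarrow> ?r")
  proof
    assume ?l then show ?r by fastforce
  next
    assume r: ?r
    show ?l
    proof (intro allI impI)
      fix as us assume c: "alternating_cycle M as us"
      show "4 < length us"
      proof (rule ccontr)
        assume "\<not> 4 < length us"
        moreover have "2 \<le> length us" "length as = length us" using c by (auto simp: alternating_cycle_def)
        ultimately consider "length us = Suc (Suc 0)" "length as = Suc (Suc 0)"
          | "length us = Suc (Suc (Suc 0))" "length as = Suc (Suc (Suc 0))"
          | "length us = Suc (Suc (Suc (Suc 0)))" "length as = Suc (Suc (Suc (Suc 0)))"
          by linarith
        then show False using r c by cases (auto simp: length_Suc_conv)
      qed
    qed
  qed
  then show ?thesis using girth_gt_iff[of 4 M] by (simp add: numeral_eq_enat)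
qed

section \<open>Girth above 8 in terms of shared columns\<close>

text \<open>Adjacency of check nodes at distance 2. For the block matrix this is the support of
  \<open>C_mat P\<close>, so the combinatorics can be settled before any matrix product
  appears.\<close>

definition share_column :: "int ^ 'v ^ 'c \<Rightarrow> 'c \<Rightarrow> 'c \<Rightarrow> bool" where
  "share_column M x y \<longleftrightarrow> x \<noteq> y \<and> (\<exists>z. 0 < M $ x $ z \<and> 0 < M $ y $ z)"

lemma share_column_commute: "share_column M x y \<longleftrightarrow> share_column M y x"
  by (auto simp: share_column_def)

text \<open>The map \<open>p\<close> sends a row to its block. Of the permutation structure only
  this is kept: in each block, every column has exactly one positive entry.\<close>

lemma girth_gt_8_iff_share_column:
  fixes M :: "int ^ 'v ^ 'c" and p :: "'c \<Rightarrow> 'k"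
  assumes le1: "\<And>a b. M $ a $ b \<le> 1"
    and ex: "\<And>z i. \<exists>x. p x = i \<and> 0 < M $ x $ z"
    and uniq: "\<And>x y z. p x = p y \<Longrightarrow> 0 < M $ x $ z \<Longrightarrow> 0 < M $ y $ z \<Longrightarrow> x = y"
  shows "girth M > 8 \<longleftrightarrow>
    (\<forall>a b u v. \<not> alternating_cycle M [a, b] [u, v]) \<and>
    (\<forall>x y w w'. x \<noteq> y \<and> w \<noteq> w' \<and> share_column M x w \<and> share_column M w y \<and>
       share_column M x w' \<and> share_column M w' y \<longrightarrow> share_column M x y)"
    (is "_ \<longleftrightarrow> ?no4 \<and> ?sq")
proof
  assume "girth M > 8"
  then have no4: ?no4
    and no6: "\<And>a b c u v w. \<not> alternating_cycle M [a, b, c] [u, v, w]"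
    and no8: "\<And>a b c d u v w x. \<not> alternating_cycle M [a, b, c, d] [u, v, w, x]"
    by (auto simp: girth_gt_8_iff)
  have ?sq
  proof (intro allI impI, elim conjE, rule ccontr)
    fix a c b d
    assume ne: "a \<noteq> c" "b \<noteq> d" and s: "share_column M a b" "share_column M b c"
      "share_column M a d" "share_column M d c" and ac: "\<not> share_column M a c"
    obtain u v w x where h: "0 < M $ a $ u" "0 < M $ b $ u" "0 < M $ b $ v" "0 < M $ c $ v"
        "0 < M $ c $ w" "0 < M $ d $ w" "0 < M $ d $ x" "0 < M $ a $ x"
      using s by (auto simp: share_column_def)
    have ne': "a \<noteq> b" "b \<noteq> c" "a \<noteq> d" "d \<noteq> c" using s by (auto simp: share_column_def)
    have no: "\<not> (0 < M $ a $ z \<and> 0 < M $ c $ z)" for z using ac ne by (auto simp: share_column_def)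
    \<comment> \<open>The columns run around the closed walk \<open>a u b v c w d x\<close>. Since
      \<open>a\<close> and \<open>c\<close> share no column, \<open>u\<close> and \<open>x\<close>,
      which meet \<open>a\<close>, differ from \<open>v\<close> and \<open>w\<close>, which meet
      \<open>c\<close>.\<close>
    have d: "u \<noteq> v" "w \<noteq> x" "u \<noteq> w" "v \<noteq> x" using h no by auto
    \<comment> \<open>Only \<open>u = x\<close> and \<open>v = w\<close> remain possible: both
      together give a 4-cycle through \<open>b\<close> and \<open>d\<close>, exactly one gives a
      6-cycle, and none gives an 8-cycle.\<close>
    show False
    proof (cases "u = x")
      case True
      show False
      proof (cases "v = w")
        case True
        then show False using no4 \<open>u = x\<close> h d ne by (auto simp: alternating_cycle_2_iff)
      next
        case False
        then show False using no6[of b d c u w v] \<open>u = x\<close> h d ne ne'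
          by (auto simp: alternating_cycle_3_iff)
      qed
    next
      case ux: False
      show False
      proof (cases "v = w")
        case True
        then show False using no6[of a b d u v x] ux h d ne ne'
          by (auto simp: alternating_cycle_3_iff)
      next
        case False
        then show False using no8[of a b c d u v w x] ux h d ne ne'
          by (auto simp: alternating_cycle_4_iff)
      qed
    qed
  qed
  with no4 show "?no4 \<and> ?sq" by blast
next
  assume "?no4 \<and> ?sq"
  then have "?no4" "?sq" by blast+
  have no4: "u = v" if "a \<noteq> b" "0 < M $ a $ u" "0 < M $ b $ u" "0 < M $ a $ v" "0 < M $ b $ v"
    for a b u v
    using \<open>?no4\<close> that unfolding alternating_cycle_2_iff by blast
  have sq: "share_column M x y"
    if "x \<noteq> y" "w \<noteq> w'" "share_column M x w" "share_column M w y"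
      "share_column M x w'" "share_column M w' y" for x y w w'
    using \<open>?sq\<close> that by blast
  text \<open>The column \<open>u\<close> of a 6-cycle also meets the part of the third row \<open>c\<close>, in a row \<open>c' \<noteq> c\<close>.
    Then \<open>c\<close> and \<open>c'\<close> both share columns with \<open>a\<close> and \<open>b\<close>, but not with each other.\<close>
  have no6: "\<not> alternating_cycle M [a, b, c] [u, v, w]" for a b c u v w
  proof
    assume "alternating_cycle M [a, b, c] [u, v, w]"
    then have n: "distinct [a, b, c]" "distinct [u, v, w]" and
      h: "0 < M $ a $ u" "0 < M $ b $ u" "0 < M $ b $ v" "0 < M $ c $ v" "0 < M $ c $ w" "0 < M $ a $ w"
      by (auto simp: alternating_cycle_3_iff)
    obtain c' where c': "p c' = p c" "0 < M $ c' $ u" using ex by blast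
    \<comment> \<open>Otherwise \<open>b\<close> and \<open>c\<close> would share both
      \<open>u\<close> and \<open>v\<close>.\<close>
    have cc: "c' \<noteq> c" using no4[of b c u v] n h c' by auto
    \<comment> \<open>Otherwise \<open>c\<close> would lie in the block of \<open>a\<close> or
      \<open>b\<close>, although it shares \<open>w\<close> with \<open>a\<close> and
      \<open>v\<close> with \<open>b\<close>.\<close>
    have "c' \<noteq> a" "c' \<noteq> b" using uniq[of a c w] uniq[of b c v] n h c' by auto
    then have "share_column M c c'"
      using sq[of c c' a b] cc n h c' unfolding share_column_def by auto
    then show False using uniq c' unfolding share_column_def by metis
  qed
  moreover have "\<not> alternating_cycle M [a, b, c, d] [u, v, w, x]" for a b c d u v w x
  proof
    assume "alternating_cycle M [a, b, c, d] [u, v, w, x]"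
    then have n: "distinct [a, b, c, d]" "distinct [u, v, w, x]" and
      h: "0 < M $ a $ u" "0 < M $ b $ u" "0 < M $ b $ v" "0 < M $ c $ v"
        "0 < M $ c $ w" "0 < M $ d $ w" "0 < M $ d $ x" "0 < M $ a $ x"
      by (auto simp: alternating_cycle_4_iff)
    \<comment> \<open>Opposite rows of the 8-cycle are joined by two paths, through \<open>b\<close>
      and through \<open>d\<close>. The resulting common column \<open>t\<close> is a chord that
      closes the half through \<open>b\<close> to a 6-cycle.\<close>
    have "share_column M a c"
      using sq[of a c b d] n h unfolding share_column_def by auto
    then obtain t where t: "0 < M $ a $ t" "0 < M $ c $ t" by (auto simp: share_column_def)
    have "t \<noteq> u" using no4[of b c u v] n h t by auto
    moreover have "t \<noteq> v" using no4[of a b u v] n h t by auto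
    ultimately show False using no6[of a b c u v t] n h t by (auto simp: alternating_cycle_3_iff)
  qed
  ultimately show "girth M > 8"
    using le1 \<open>?no4 \<and> ?sq\<close> by (simp add: girth_gt_8_iff)
qed

section \<open>Entries of \<open>C_mat P\<close> and of its square\<close>

text \<open>A sum of zeros and ones counts its positive terms. For an entry of a matrix product, the
  value 2 thus means two different intermediate indices.\<close>

lemma two_le_sum_iff:
  fixes f :: "'a \<Rightarrow> int"
  assumes "finite A" "\<And>z. z \<in> A \<Longrightarrow> 0 \<le> f z" "\<And>z. z \<in> A \<Longrightarrow> f z \<le> 1"
  shows "2 \<le> sum f A \<longleftrightarrow> (\<exists>z\<in>A. \<exists>z'\<in>A. z \<noteq> z' \<and> 0 < f z \<and> 0 < f z')"
proof -
  have "sum f A = sum f {z\<in>A. 0 < f z}"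
    by (rule sum.mono_neutral_right) (use assms in \<open>force+\<close>)
  also have "\<dots> = (\<Sum>z\<in>{z\<in>A. 0 < f z}. 1)"
    by (rule sum.cong) (use assms in \<open>force+\<close>)
  finally have "2 \<le> sum f A \<longleftrightarrow> \<not> card {z\<in>A. 0 < f z} \<le> Suc 0" by auto
  also have "\<dots> \<longleftrightarrow> (\<exists>z\<in>A. \<exists>z'\<in>A. z \<noteq> z' \<and> 0 < f z \<and> 0 < f z')"
    using assms(1) by (subst card_le_Suc0_iff_eq) auto
  finally show ?thesis .
qed

lemma tri_mat_eq_0_iff: "E \<triangle> F = 0 \<longleftrightarrow> (\<forall>a b. 2 \<le> E $ a $ b \<longrightarrow> F $ a $ b \<noteq> 0)"
  by (auto simp: tri_mat_def tri_def vec_eq_iff)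

lemma C_block_nth:
  "C_block P i j $ r $ s = (\<Sum>k\<in>UNIV. \<Sum>t\<in>UNIV. P i k $ r $ t * P j k $ s $ t)"
  by (simp add: C_block_def matrix_matrix_mult_def transpose_def)

text \<open>\<open>C_block P i j\<close> is the block in position \<open>(i, j)\<close> of the
  product of \<open>block_matrix P\<close> with its transpose.\<close>

lemma C_block_nth_block_matrix:
  "C_block P i j $ r $ s = (\<Sum>z\<in>UNIV. block_matrix P $ (i, r) $ z * block_matrix P $ (j, s) $ z)"
  by (simp add: C_block_nth block_matrix_def sum.cartesian_product flip: UNIV_Times_UNIV)
    (simp add: case_prod_beta)

lemma C_mat_nth:
  "C_mat P $ x $ y = (if fst x = fst y then 0 else C_block P (fst x) (fst y) $ snd x $ snd y)"
  by (simp add: C_mat_def block_matrix_def)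

text \<open>The zero diagonal blocks of \<open>C_mat P\<close> remove both \<open>l = i\<close> and
  \<open>l = j\<close> from the sum.\<close>

lemma C_mat_square_nth:
  "(C_mat P ** C_mat P) $ (i, r) $ (j, s) =
     (\<Sum>l\<in>UNIV - {i, j}. \<Sum>t\<in>UNIV. C_block P i l $ r $ t * C_block P l j $ t $ s)"
proof -
  have "(C_mat P ** C_mat P) $ (i, r) $ (j, s) =
      (\<Sum>l\<in>UNIV. \<Sum>t\<in>UNIV. C_mat P $ (i, r) $ (l, t) * C_mat P $ (l, t) $ (j, s))"
    by (simp add: matrix_matrix_mult_def sum.cartesian_product flip: UNIV_Times_UNIV)
  also have "\<dots> = (\<Sum>l\<in>UNIV - {i, j}. \<Sum>t\<in>UNIV. C_mat P $ (i, r) $ (l, t) * C_mat P $ (l, t) $ (j, s))"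
    by (rule sum.mono_neutral_right) (auto simp: C_mat_nth)
  also have "\<dots> = (\<Sum>l\<in>UNIV - {i, j}. \<Sum>t\<in>UNIV. C_block P i l $ r $ t * C_block P l j $ t $ s)"
    by (rule sum.cong) (auto simp: C_mat_nth)
  finally show ?thesis .
qed

section \<open>Block matrices of permutation matrices\<close>

context
  fixes P :: "'c::finite \<Rightarrow> 'v::finite \<Rightarrow> int ^ 'n::finite ^ 'n"
  assumes perm: "\<And>i j. permutation_matrix (P i j)"
begin

lemma block_matrix_range: "0 \<le> block_matrix P $ x $ z" "block_matrix P $ x $ z \<le> 1"
proof -
  obtain \<pi> where "P (fst x) (fst z) = (\<chi> r c. if c = \<pi> r then 1 else 0)"
    using perm unfolding permutation_matrix_def by blast
  then show "0 \<le> block_matrix P $ x $ z" "block_matrix P $ x $ z \<le> 1"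
    by (auto simp: block_matrix_def)
qed

text \<open>Surjectivity of the permutation in the block gives existence; uniqueness, below, is its
  injectivity.\<close>

lemma block_matrix_column_meets_block: "\<exists>x. fst x = i \<and> 0 < block_matrix P $ x $ z"
proof -
  obtain \<pi> where p: "bij \<pi>" "P i (fst z) = (\<chi> r c. if c = \<pi> r then 1 else 0)"
    using perm unfolding permutation_matrix_def by blast
  obtain r where "snd z = \<pi> r" using p(1) by (metis bij_pointE)
  then have "0 < block_matrix P $ (i, r) $ z" using p by (simp add: block_matrix_def)
  then show ?thesis by force
qed

lemma block_matrix_column_unique:
  assumes "fst x = fst y" "0 < block_matrix P $ x $ z" "0 < block_matrix P $ y $ z"
  shows "x = y"
proof -
  obtain \<pi> where p: "bij \<pi>" "P (fst y) (fst z) = (\<chi> r c. if c = \<pi> r then 1 else 0)"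
    using perm unfolding permutation_matrix_def by blast
  then have "\<pi> (snd x) = \<pi> (snd y)"
    using assms by (auto simp: block_matrix_def split: if_splits)
  then show ?thesis using p(1) assms(1) by (metis bij_is_inj injD prod_eqI)
qed

lemma block_matrix_mult_range:
  "0 \<le> block_matrix P $ x $ z * block_matrix P $ y $ z"
  "block_matrix P $ x $ z * block_matrix P $ y $ z \<le> 1"
  "0 < block_matrix P $ x $ z * block_matrix P $ y $ z \<longleftrightarrow> 0 < block_matrix P $ x $ z \<and> 0 < block_matrix P $ y $ z"
  using block_matrix_range[of x z] block_matrix_range[of y z]
  by (auto simp: zero_less_mult_iff intro: mult_le_one)

lemma C_block_nonneg: "0 \<le> C_block P i j $ r $ s"
  by (simp add: C_block_nth_block_matrix sum_nonneg block_matrix_mult_range)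

lemma C_block_eq_0_iff:
  "C_block P i j $ r $ s = 0 \<longleftrightarrow>
     (\<nexists>z. 0 < block_matrix P $ (i, r) $ z \<and> 0 < block_matrix P $ (j, s) $ z)"
proof -
  have "C_block P i j $ r $ s = 0 \<longleftrightarrow>
      (\<forall>z. block_matrix P $ (i, r) $ z * block_matrix P $ (j, s) $ z = 0)"
    by (simp only: C_block_nth_block_matrix) (subst sum_nonneg_eq_0_iff; simp add: block_matrix_mult_range)
  also have "\<dots> \<longleftrightarrow> (\<forall>z. \<not> 0 < block_matrix P $ (i, r) $ z * block_matrix P $ (j, s) $ z)"
    using block_matrix_mult_range(1) by (metis less_le)
  finally show ?thesis by (simp only: block_matrix_mult_range) blast
qed

text \<open>A row always meets some column, hence shares one with itself; different rows of one
  block share none.\<close>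

lemma C_block_diagonal_eq_0_iff: "C_block P i i $ r $ s = 0 \<longleftrightarrow> r \<noteq> s"
proof -
  \<comment> \<open>Any block column would do; one exists because types are nonempty.\<close>
  define k :: 'v where "k = undefined"
  obtain \<pi> where "P i k = (\<chi> r c. if c = \<pi> r then 1 else 0)"
    using perm unfolding permutation_matrix_def by blast
  then have "0 < block_matrix P $ (i, r) $ (k, \<pi> r)" by (simp add: block_matrix_def)
  then show ?thesis
    using block_matrix_column_unique[of "(i, r)" "(i, s)"] by (fastforce simp: C_block_eq_0_iff)
qed

lemma C_mat_nonneg: "0 \<le> C_mat P $ x $ y"
  by (simp add: C_mat_nth C_block_nonneg)

lemma C_mat_pos_iff: "0 < C_mat P $ x $ y \<longleftrightarrow> share_column (block_matrix P) x y"
proof -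
  have "0 < C_mat P $ x $ y \<longleftrightarrow> C_mat P $ x $ y \<noteq> 0"
    using C_mat_nonneg[of x y] by auto
  then show ?thesis
    using block_matrix_column_unique[of x y]
    by (auto simp: C_mat_nth C_block_eq_0_iff share_column_def)
qed

lemma share_column_imp_distinct_blocks: "share_column (block_matrix P) x y \<Longrightarrow> fst x \<noteq> fst y"
  using block_matrix_column_unique unfolding share_column_def by metis

lemma C_mat_tri_0_iff: "C_mat P \<triangle> 0 = 0 \<longleftrightarrow> (\<forall>x y. C_mat P $ x $ y \<le> 1)"
proof -
  have "C_mat P $ x $ y \<le> 1 \<longleftrightarrow> \<not> 2 \<le> C_mat P $ x $ y" for x y by auto
  then show ?thesis by (simp add: tri_mat_eq_0_iff)
qed

text \<open>Off the diagonal blocks an entry counts the common columns of two rows, and two common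
  columns form a 4-cycle. Rows of one block have no common column, in accordance with the zero
  diagonal blocks.\<close>

lemma C_mat_le_1_iff:
  "(\<forall>x y. C_mat P $ x $ y \<le> 1) \<longleftrightarrow> (\<forall>a b u v. \<not> alternating_cycle (block_matrix P) [a, b] [u, v])"
proof -
  have "2 \<le> C_mat P $ x $ y \<longleftrightarrow> (\<exists>u v. alternating_cycle (block_matrix P) [x, y] [u, v])" for x y
  proof (cases "fst x = fst y")
    case True
    then show ?thesis
      using block_matrix_column_unique[of x y] by (auto simp: C_mat_nth alternating_cycle_2_iff)
  next
    case False
    then have "C_mat P $ x $ y = (\<Sum>z\<in>UNIV. block_matrix P $ x $ z * block_matrix P $ y $ z)"
      by (simp add: C_mat_nth C_block_nth_block_matrix)
    then show ?thesis using False
      by (auto simp: two_le_sum_iff block_matrix_mult_range alternating_cycle_2_iff)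
  qed
  moreover have "C_mat P $ x $ y \<le> 1 \<longleftrightarrow> \<not> 2 \<le> C_mat P $ x $ y" for x y by auto
  ultimately show ?thesis by blast
qed

text \<open>With entries 0 and 1 the square counts intermediate rows. Without \<open>le1\<close> a
  single intermediate row could already contribute 2.\<close>

lemma C_mat_square_ge_2_iff:
  assumes le1: "\<And>x y. C_mat P $ x $ y \<le> 1"
  shows "2 \<le> (C_mat P ** C_mat P) $ x $ y \<longleftrightarrow>
    (\<exists>w w'. w \<noteq> w' \<and> share_column (block_matrix P) x w \<and> share_column (block_matrix P) w y \<and>
       share_column (block_matrix P) x w' \<and> share_column (block_matrix P) w' y)"
proof -
  have *: "0 \<le> C_mat P $ x $ w * C_mat P $ w $ y" "C_mat P $ x $ w * C_mat P $ w $ y \<le> 1"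
      "0 < C_mat P $ x $ w * C_mat P $ w $ y \<longleftrightarrow>
        share_column (block_matrix P) x w \<and> share_column (block_matrix P) w y" for w
    using C_mat_nonneg[of x w] C_mat_nonneg[of w y] le1[of x w] le1[of w y]
    unfolding C_mat_pos_iff[symmetric]
    by (auto simp: zero_less_mult_iff intro: mult_le_one)
  show ?thesis
    by (simp add: matrix_matrix_mult_def two_le_sum_iff *)
qed

lemma tri_conditions_iff_share_column:
  "C_mat P \<triangle> 0 = 0 \<and> (C_mat P ** C_mat P) \<triangle> (mat 1 + C_mat P) = 0 \<longleftrightarrow>
    (\<forall>a b u v. \<not> alternating_cycle (block_matrix P) [a, b] [u, v]) \<and>
    (\<forall>x y w w'. x \<noteq> y \<and> w \<noteq> w' \<and> share_column (block_matrix P) x w \<and> share_column (block_matrix P) w y \<and>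
       share_column (block_matrix P) x w' \<and> share_column (block_matrix P) w' y \<longrightarrow>
       share_column (block_matrix P) x y)"
proof -
  \<comment> \<open>Both summands are non-negative, so nothing cancels; the identity exempts the
    pairs \<open>x = y\<close>, which yields the condition \<open>x \<noteq> y\<close> on the
    right-hand side.\<close>
  have nz: "(mat 1 + C_mat P) $ x $ y \<noteq> 0 \<longleftrightarrow> x = y \<or> share_column (block_matrix P) x y" for x y
    using C_mat_nonneg[of x y] by (auto simp: mat_def simp flip: C_mat_pos_iff)
  show ?thesis
  proof (cases "\<forall>x y. C_mat P $ x $ y \<le> 1")
    case True
    then have ge2: "2 \<le> (C_mat P ** C_mat P) $ x $ y \<longleftrightarrow>
      (\<exists>w w'. w \<noteq> w' \<and> share_column (block_matrix P) x w \<and> share_column (block_matrix P) w y \<and>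
         share_column (block_matrix P) x w' \<and> share_column (block_matrix P) w' y)" for x y
      by (intro C_mat_square_ge_2_iff) blast
    have "(C_mat P ** C_mat P) \<triangle> (mat 1 + C_mat P) = 0 \<longleftrightarrow>
      (\<forall>x y w w'. x \<noteq> y \<and> w \<noteq> w' \<and> share_column (block_matrix P) x w \<and> share_column (block_matrix P) w y \<and>
         share_column (block_matrix P) x w' \<and> share_column (block_matrix P) w' y \<longrightarrow>
         share_column (block_matrix P) x y)"
      unfolding tri_mat_eq_0_iff nz ge2 by blast
    then show ?thesis by (simp only: C_mat_tri_0_iff C_mat_le_1_iff)
  next
    \<comment> \<open>An entry of at least 2 makes the first conjunct fail on both sides, so the
      square need not be interpreted here.\<close>
    case False
    then show ?thesis by (simp only: C_mat_tri_0_iff C_mat_le_1_iff) simp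
  qed
qed

lemma girth_block_matrix_gt_8_iff:
  "girth (block_matrix P) > 8 \<longleftrightarrow>
     C_mat P \<triangle> 0 = 0 \<and> (C_mat P ** C_mat P) \<triangle> (mat 1 + C_mat P) = 0"
  unfolding tri_conditions_iff_share_column
  by (rule girth_gt_8_iff_share_column[where p = fst])
    (use block_matrix_range block_matrix_column_meets_block block_matrix_column_unique in blast)+

section \<open>Blockwise conditions and the girth of \<open>C_mat P\<close>\<close>

lemma C_mat_tri_0_iff_blocks:
  "C_mat P \<triangle> 0 = 0 \<longleftrightarrow> (\<forall>i j. i \<noteq> j \<longrightarrow> C_block P i j \<triangle> 0 = 0)"
  by (auto simp: tri_mat_eq_0_iff C_mat_nth)

text \<open>The sum over \<open>l \<noteq> j\<close> contains, for \<open>i \<noteq> j\<close>, the term \<open>C_block P i i ** C_block P i j\<close>, which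
  \<open>C_mat P ** C_mat P\<close> lacks. It is a multiple of \<open>C_block P i j\<close>, so it vanishes wherever the
  second argument of \<open>\<triangle>\<close> does.\<close>
lemma C_mat_square_tri_iff_blocks:
  "(C_mat P ** C_mat P) \<triangle> (mat 1 + C_mat P) = 0 \<longleftrightarrow>
    (\<forall>i j. (\<Sum>l\<in>UNIV - {j}. C_block P i l ** C_block P l j) \<triangle> C_block P i j = 0)"
proof -
  \<comment> \<open>For \<open>i = j\<close> the left-hand side is an entry of the identity, which
    has the same zeros as the diagonal block \<open>C_block P i i\<close>.\<close>
  have nz: "(mat 1 + C_mat P) $ (i, r) $ (j, s) = 0 \<longleftrightarrow> C_block P i j $ r $ s = 0" for i j r s
    by (cases "i = j") (auto simp: mat_def C_mat_nth C_block_diagonal_eq_0_iff)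
  have eq: "(C_mat P ** C_mat P) $ (i, r) $ (j, s) =
      (\<Sum>l\<in>UNIV - {j}. C_block P i l ** C_block P l j) $ r $ s"
    if z: "C_block P i j $ r $ s = 0" for i j r s
  proof -
    \<comment> \<open>The first factor vanishes unless \<open>t = r\<close>, and then the second
      factor is the entry assumed to be zero.\<close>
    have "C_block P i i $ r $ t * C_block P i j $ t $ s = 0" for t
      using z C_block_diagonal_eq_0_iff[of i r t] by (cases "t = r") auto
    then have "(\<Sum>l\<in>UNIV - {i, j}. \<Sum>t\<in>UNIV. C_block P i l $ r $ t * C_block P l j $ t $ s) =
      (\<Sum>l\<in>UNIV - {j}. \<Sum>t\<in>UNIV. C_block P i l $ r $ t * C_block P l j $ t $ s)"
      by (intro sum.mono_neutral_left) (auto intro!: sum.neutral)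
    then show ?thesis
      unfolding C_mat_square_nth by (simp add: matrix_matrix_mult_def)
  qed
  have "(2 \<le> (C_mat P ** C_mat P) $ (i, r) $ (j, s) \<longrightarrow> (mat 1 + C_mat P) $ (i, r) $ (j, s) \<noteq> 0) \<longleftrightarrow>
      (2 \<le> (\<Sum>l\<in>UNIV - {j}. C_block P i l ** C_block P l j) $ r $ s \<longrightarrow> C_block P i j $ r $ s \<noteq> 0)"
    for i j r s
    using nz[of i r j s] eq[of i j r s] by auto
  then show ?thesis
    by (simp only: tri_mat_eq_0_iff split_paired_All) blast
qed

text \<open>In the Tanner graph of \<open>C_mat P\<close> each check node occurs once as a row and
  once as a column. A 4-cycle has rows \<open>x\<close>, \<open>y\<close> and columns
  \<open>w\<close>, \<open>w'\<close>; symmetry of \<open>share_column\<close> lets it be read as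
  two paths from \<open>x\<close> to \<open>y\<close>.\<close>

lemma girth_C_mat_gt_4_iff:
  "girth (C_mat P) > 4 \<longleftrightarrow>
    (\<forall>x y. C_mat P $ x $ y \<le> 1) \<and>
    (\<forall>x y w w'. \<not> (x \<noteq> y \<and> w \<noteq> w' \<and> share_column (block_matrix P) x w \<and> share_column (block_matrix P) w y \<and>
       share_column (block_matrix P) x w' \<and> share_column (block_matrix P) w' y))"
  unfolding girth_gt_4_iff alternating_cycle_2_iff C_mat_pos_iff
  using share_column_commute by blast

end

theorem theorem8:
  fixes P :: "'c::finite \<Rightarrow> 'v::finite \<Rightarrow> int ^ 'n::finite ^ 'n"
  assumes "\<And>i j. permutation_matrix (P i j)"
  shows
    "(girth (block_matrix P) > 8 \<longleftrightarrow>
        C_mat P \<triangle> 0 = 0 \<and> (C_mat P ** C_mat P) \<triangle> (mat 1 + C_mat P) = 0)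
     \<and>
     (girth (block_matrix P) > 8 \<longleftrightarrow>
        (\<forall>i j. i \<noteq> j \<longrightarrow> C_block P i j \<triangle> 0 = 0) \<and>
        (\<forall>i j. (\<Sum>l\<in>UNIV - {j}. C_block P i l ** C_block P l j) \<triangle> C_block P i j = 0))
     \<and>
     (CARD('c) = 3 \<longrightarrow> (girth (block_matrix P) > 8 \<longleftrightarrow> girth (C_mat P) > 4))"
proof (intro conjI impI)
  show "girth (block_matrix P) > 8 \<longleftrightarrow>
      C_mat P \<triangle> 0 = 0 \<and> (C_mat P ** C_mat P) \<triangle> (mat 1 + C_mat P) = 0"
    using girth_block_matrix_gt_8_iff[of P, OF assms] .
  then show "girth (block_matrix P) > 8 \<longleftrightarrow>
      (\<forall>i j. i \<noteq> j \<longrightarrow> C_block P i j \<triangle> 0 = 0) \<and>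
      (\<forall>i j. (\<Sum>l\<in>UNIV - {j}. C_block P i l ** C_block P l j) \<triangle> C_block P i j = 0)"
    by (simp add: C_mat_tri_0_iff_blocks[of P, OF assms] C_mat_square_tri_iff_blocks[of P, OF assms])
next
  assume "CARD('c) = 3"
  \<comment> \<open>Numbering the blocks turns the pigeonhole argument into arithmetic: four
    pairwise different numbers below 3.\<close>
  then obtain f :: "'c \<Rightarrow> nat" where f: "bij_betw f UNIV {0..<3}"
    using ex_bij_betw_finite_nat[of "UNIV :: 'c set"] by auto
  let ?S = "share_column (block_matrix P)"
  have "\<not> (x \<noteq> y \<and> w \<noteq> w' \<and> ?S x w \<and> ?S w y \<and> ?S x w' \<and> ?S w' y)"
    if sq: "\<forall>x y w w'. x \<noteq> y \<and> w \<noteq> w' \<and> ?S x w \<and> ?S w y \<and> ?S x w' \<and> ?S w' y \<longrightarrow> ?S x y" for x y w w'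
  proof
    assume a: "x \<noteq> y \<and> w \<noteq> w' \<and> ?S x w \<and> ?S w y \<and> ?S x w' \<and> ?S w' y"
    \<comment> \<open>The condition applies to both opposite pairs: \<open>x\<close>,
      \<open>y\<close> are joined through \<open>w\<close> and \<open>w'\<close>, and
      \<open>w\<close>, \<open>w'\<close> through \<open>x\<close> and \<open>y\<close>. So all six
      pairs share columns and lie in different blocks.\<close>
    then have "?S x y" "?S w w'" using sq share_column_commute by blast+
    moreover have "f (fst z) < 3" for z :: "'c \<times> 'n" using bij_betw_apply[OF f] by simp
    moreover have "f (fst z) \<noteq> f (fst z')" if "?S z z'" for z z'
      using share_column_imp_distinct_blocks[of P, OF assms that] bij_betw_imp_inj_on[OF f]
      by (simp add: inj_eq)
    ultimately have "f (fst x) < 3" "f (fst y) < 3" "f (fst w) < 3" "f (fst w') < 3"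
      "f (fst x) \<noteq> f (fst y)" "f (fst x) \<noteq> f (fst w)" "f (fst x) \<noteq> f (fst w')"
      "f (fst w) \<noteq> f (fst y)" "f (fst w') \<noteq> f (fst y)" "f (fst w) \<noteq> f (fst w')"
      using a by simp_all
    then show False by presburger
  qed
  \<comment> \<open>Conversely, if no such quadruple exists, the condition on the square holds
    vacuously.\<close>
  then show "girth (block_matrix P) > 8 \<longleftrightarrow> girth (C_mat P) > 4"
    unfolding girth_block_matrix_gt_8_iff[of P, OF assms] tri_conditions_iff_share_column[of P, OF assms]
      girth_C_mat_gt_4_iff[of P, OF assms] C_mat_le_1_iff[of P, OF assms]
    by blast
qed

end
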